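(* Every finite group is isomorphic to a subgroup of ${\rm Aut}_{\mathfrak M^+}(\widetilde{\mathcal M}_\infty)={\rm Aut}_{\mathfrak H^+}(\widetilde{\mathcal H}_\infty)$.
   Context: Permutational categories: the permutational category $\mathfrak C$ with parent group $\Gamma$ is (up to natural isomorphism) the category whose objects are permutation representations $\theta:\Gamma\to{\rm Sym}(\Omega)$ (permutations act on the right), with morphisms the functions $\Omega_1\to\Omega_2$ commuting with the actions of $\Gamma$. The monodromy group of an object is $\theta(\Gamma)$, and its automorphism group ${\rm Aut}_{\mathfrak C}$ is the group of all permutations of $\Omega$ commuting with the action of $\Gamma$. The category $\mathfrak M^+$ of oriented maps has parent group $\Delta(\infty,2,\infty)=\langle X,Y,Z\mid Y^2=XYZ=1\rangle\cong C_\infty*C_2$, and the category $\mathfrak H^+$ of oriented hypermaps has parent group $\Delta(\infty,\infty,\infty)=\langle X,Y,Z\mid XYZ=1\rangle\cong F_2$. Let $x$ and $y$ be the permutations of $\mathbb Z$ given by $x:i\mapsto i+1$ and $y=(0,1)$ (the transposition of $0$ and $1$), and let $P=\langle x,y\rangle\le{\rm Sym}(\mathbb Z)$. The oriented map $\mathcal M_\infty$ is the object of $\mathfrak M^+$ corresponding to the transitive representation $\Delta(\infty,2,\infty)\to P$, $X\mapsto x$, $Y\mapsto y$, on $\mathbb Z$ (geometrically, a planar map with one vertex of infinite valency, one loop, and infinitely many free edges). The oriented hypermap $\mathcal H_\infty$ is the object of $\mathfrak H^+$ corresponding to the transitive representation $\Delta(\infty,\infty,\infty)\to P$, $X\mapsto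 x$, $Y\mapsto y$, on $\mathbb Z$. The minimal regular cover of a connected object with monodromy representation $\theta:\Gamma\to G=\theta(\Gamma)$ is the object given by $\Gamma$ acting, via $\theta$, on $G$ by right multiplication (equivalently, the object corresponding to the normal subgroup $\ker\theta$ of $\Gamma$). The objects $\widetilde{\mathcal M}_\infty$ and $\widetilde{\mathcal H}_\infty$ are the minimal regular covers of $\mathcal M_\infty$ in $\mathfrak M^+$ and of $\mathcal H_\infty$ in $\mathfrak H^+$. *)

theory Defs
  imports "HOL-Algebra.Bij" "HOL-Algebra.Generated_Groups" "HOL-Combinatorics.Transposition"
begin

section \<open>Groups given by presentations\<close>

text \<open>A letter \<open>(g, True)\<close> stands for the generator \<open>g\<close>, and \<open>(g, False)\<close> for its inverse.
  Every element of the type \<open>'g\<close> is a generator; \<open>R\<close> is the set of relators.\<close>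

type_synonym 'g word = "('g \<times> bool) list"

inductive pres_cong :: "'g word set \<Rightarrow> 'g word \<Rightarrow> 'g word \<Rightarrow> bool" for R where
  refl: "pres_cong R u u"
| sym: "pres_cong R u v \<Longrightarrow> pres_cong R v u"
| trans: "pres_cong R u v \<Longrightarrow> pres_cong R v w \<Longrightarrow> pres_cong R u w"
| cancel: "pres_cong R (u @ [(g, b), (g, \<not> b)] @ v) (u @ v)"
| relator: "r \<in> R \<Longrightarrow> pres_cong R (u @ r @ v) (u @ v)"

definition pres_class :: "'g word set \<Rightarrow> 'g word \<Rightarrow> 'g word set" where
  "pres_class R w = {v. pres_cong R w v}"

definition presented_group :: "'g word set \<Rightarrow> 'g word set monoid" where
  "presented_group R =
    \<lparr>carrier = range (pres_class R),
     mult = (\<lambda>A B. \<Union>u\<in>A. \<Union>v\<in>B. pres_class R (u @ v)),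
     one = pres_class R []\<rparr>"

definition pres_gen :: "'g word set \<Rightarrow> 'g \<Rightarrow> 'g word set" where
  "pres_gen R g = pres_class R [(g, True)]"

fun word_value :: "('a, 'b) monoid_scheme \<Rightarrow> ('g \<Rightarrow> 'a) \<Rightarrow> 'g word \<Rightarrow> 'a" where
  "word_value G f [] = \<one>\<^bsub>G\<^esub>"
| "word_value G f ((g, b) # w) = (if b then f g else inv\<^bsub>G\<^esub> f g) \<otimes>\<^bsub>G\<^esub> word_value G f w"

text \<open>The homomorphism extending an assignment \<open>f\<close> of the generators. It is meaningful only if
  every relator has value one under \<open>f\<close>; see \<open>induced_hom_in_hom\<close> and \<open>induced_hom_gen\<close>.\<close>

definition induced_hom :: "('a, 'b) monoid_scheme \<Rightarrow> ('g \<Rightarrow> 'a) \<Rightarrow> 'g word set \<Rightarrow> 'a" where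
  "induced_hom G f A = the_elem (word_value G f ` A)"

lemma pres_cong_left: "pres_cong R u v \<Longrightarrow> pres_cong R (w @ u) (w @ v)"
proof (induction rule: pres_cong.induct)
  case (cancel u g b v)
  then show ?case using pres_cong.cancel[of R "w @ u" g b v] by simp
next
  case (relator r u v)
  then show ?case using pres_cong.relator[of r R "w @ u" v] by simp
qed (blast intro: pres_cong.intros)+

lemma pres_cong_right: "pres_cong R u v \<Longrightarrow> pres_cong R (u @ w) (v @ w)"
proof (induction rule: pres_cong.induct)
  case (cancel u g b v)
  then show ?case using pres_cong.cancel[of R u g b "v @ w"] by simp
next
  case (relator r u v)
  then show ?case using pres_cong.relator[of r R u "v @ w"] by simp
qed (blast intro: pres_cong.intros)+

lemma pres_class_eq_iff: "pres_class R u = pres_class R v \<longleftrightarrow> pres_cong R u v"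
  unfolding pres_class_def
  by (metis (mono_tags, lifting) Collect_cong mem_Collect_eq pres_cong.refl pres_cong.sym pres_cong.trans)

lemma presented_group_mult:
  "pres_class R u \<otimes>\<^bsub>presented_group R\<^esub> pres_class R v = pres_class R (u @ v)"
proof -
  have "pres_class R (u' @ v') = pres_class R (u @ v)"
    if "u' \<in> pres_class R u" "v' \<in> pres_class R v" for u' v'
  proof -
    have "pres_cong R (u @ v) (u' @ v)" "pres_cong R (u' @ v) (u' @ v')"
      using that by (simp_all add: pres_class_def pres_cong_left pres_cong_right)
    then show ?thesis
      by (metis pres_class_eq_iff)
  qed
  moreover have "u \<in> pres_class R u" "v \<in> pres_class R v"
    by (simp_all add: pres_class_def pres_cong.refl)
  ultimately show ?thesis
    unfolding presented_group_def monoid.simps by blast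
qed

lemma presented_group_carrier: "carrier (presented_group R) = range (pres_class R)"
  by (simp add: presented_group_def)

lemma presented_group_one: "\<one>\<^bsub>presented_group R\<^esub> = pres_class R []"
  by (simp add: presented_group_def)

fun inv_word :: "'g word \<Rightarrow> 'g word" where
  "inv_word [] = []"
| "inv_word ((g, b) # w) = inv_word w @ [(g, \<not> b)]"

lemma inv_word_cancel: "pres_cong R (inv_word w @ w) []"
proof (induction w rule: inv_word.induct)
  case 1
  then show ?case by (simp add: pres_cong.refl)
next
  case (2 g b w)
  have "pres_cong R (inv_word w @ [(g, \<not> b), (g, \<not> \<not> b)] @ w) (inv_word w @ w)"
    by (rule pres_cong.cancel)
  with 2 show ?case by (auto intro: pres_cong.trans)
qed

lemma presented_group_is_group: "group (presented_group R)"
proof (rule groupI)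
  fix x assume "x \<in> carrier (presented_group R)"
  then obtain w where w: "x = pres_class R w" by (auto simp: presented_group_carrier)
  have "pres_class R (inv_word w) \<otimes>\<^bsub>presented_group R\<^esub> x = \<one>\<^bsub>presented_group R\<^esub>"
    by (simp add: w presented_group_mult presented_group_one pres_class_eq_iff inv_word_cancel)
  then show "\<exists>y\<in>carrier (presented_group R). y \<otimes>\<^bsub>presented_group R\<^esub> x = \<one>\<^bsub>presented_group R\<^esub>"
    by (auto simp: presented_group_carrier)
qed (auto simp: presented_group_carrier presented_group_one presented_group_mult)

context group
begin

lemma word_value_closed: "range f \<subseteq> carrier G \<Longrightarrow> word_value G f w \<in> carrier G"
  by (induction w rule: inv_word.induct) auto

lemma word_value_append:
  "range f \<subseteq> carrier G \<Longrightarrow> word_value G f (u @ v) = word_value G f u \<otimes> word_value G f v"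
  by (induction u rule: inv_word.induct) (auto simp: word_value_closed m_assoc range_subsetD)

lemma word_value_cong:
  assumes f: "range f \<subseteq> carrier G" and R: "\<And>r. r \<in> R \<Longrightarrow> word_value G f r = \<one>"
    and "pres_cong R u v"
  shows "word_value G f u = word_value G f v"
  using \<open>pres_cong R u v\<close>
proof (induction rule: pres_cong.induct)
  case (cancel u g b v)
  have "word_value G f [(g, b), (g, \<not> b)] = \<one>"
    using f by (auto simp: range_subsetD)
  then show ?case
    by (simp only: word_value_append[OF f]) (simp add: word_value_closed[OF f])
next
  case (relator r u v)
  then show ?case by (simp add: word_value_append[OF f] R word_value_closed[OF f])
qed auto

lemma induced_hom_class:
  assumes "range f \<subseteq> carrier G" and "\<And>r. r \<in> R \<Longrightarrow> word_value G f r = \<one>"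
  shows "induced_hom G f (pres_class R w) = word_value G f w"
proof -
  have "word_value G f ` pres_class R w = {word_value G f w}"
    using word_value_cong[OF assms] by (auto simp: pres_class_def intro: pres_cong.refl)
  then show ?thesis by (simp add: induced_hom_def)
qed

lemma induced_hom_in_hom:
  assumes "range f \<subseteq> carrier G" and "\<And>r. r \<in> R \<Longrightarrow> word_value G f r = \<one>"
  shows "induced_hom G f \<in> hom (presented_group R) G"
proof (rule homI)
  show "induced_hom G f x \<in> carrier G" if "x \<in> carrier (presented_group R)" for x
    using that by (auto simp: presented_group_carrier induced_hom_class[OF assms] word_value_closed assms(1))
  show "induced_hom G f (x \<otimes>\<^bsub>presented_group R\<^esub> y) = induced_hom G f x \<otimes> induced_hom G f y"
    if "x \<in> carrier (presented_group R)" "y \<in> carrier (presented_group R)" for x y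
    using that
    by (auto simp: presented_group_carrier presented_group_mult induced_hom_class[OF assms]
        word_value_append assms(1))
qed

lemma induced_hom_gen:
  assumes "range f \<subseteq> carrier G" and "\<And>r. r \<in> R \<Longrightarrow> word_value G f r = \<one>"
  shows "induced_hom G f (pres_gen R g) = f g"
  using assms(1) by (auto simp: pres_gen_def induced_hom_class[OF assms] range_subsetD)

lemma induced_hom_image:
  assumes "range f \<subseteq> carrier G" and "\<And>r. r \<in> R \<Longrightarrow> word_value G f r = \<one>"
  shows "induced_hom G f ` carrier (presented_group R) = generate G (range f)"
proof
  have "word_value G f w \<in> generate G (range f)" for w
    by (induction w rule: inv_word.induct)
      (auto intro!: generate.one generate.eng intro: generate.incl generate.inv)
  then show "induced_hom G f ` carrier (presented_group R) \<subseteq> generate G (range f)"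
    by (auto simp: presented_group_carrier induced_hom_class[OF assms])
  interpret h: group_hom "presented_group R" G "induced_hom G f"
    by (simp add: group_hom_def group_hom_axioms_def presented_group_is_group is_group
        induced_hom_in_hom[OF assms])
  have "range f \<subseteq> induced_hom G f ` carrier (presented_group R)"
    by (metis (no_types, lifting) image_subset_iff induced_hom_gen[OF assms] pres_gen_def
        presented_group_carrier rangeI image_eqI)
  then show "generate G (range f) \<subseteq> induced_hom G f ` carrier (presented_group R)"
    by (rule generate_subgroup_incl[OF _ h.img_is_subgroup])
qed

end


section \<open>Permutational categories\<close>

text \<open>The symmetric group with permutations acting on the right: the product of \<open>f\<close> and \<open>g\<close> is
  \<open>f\<close> followed by \<open>g\<close>, so the library's \<open>BijGroup\<close> multiplication is reversed.\<close>

definition SymR :: "'p set \<Rightarrow> ('p \<Rightarrow> 'p) monoid" where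
  "SymR \<Omega> = (BijGroup \<Omega>)\<lparr>mult := (\<lambda>f g. g \<otimes>\<^bsub>BijGroup \<Omega>\<^esub> f)\<rparr>"

record ('g, 'p) perm_obj =
  points :: "'p set"
  act :: "'g \<Rightarrow> 'p \<Rightarrow> 'p"

definition is_perm_obj :: "('g, 'c) monoid_scheme \<Rightarrow> ('g, 'p) perm_obj \<Rightarrow> bool" where
  "is_perm_obj \<Gamma> A \<longleftrightarrow> act A \<in> hom \<Gamma> (SymR (points A))"

definition perm_morphisms ::
  "('g, 'c) monoid_scheme \<Rightarrow> ('g, 'p) perm_obj \<Rightarrow> ('g, 'q) perm_obj \<Rightarrow> ('p \<Rightarrow> 'q) set" where
  "perm_morphisms \<Gamma> A B =
    {f \<in> points A \<rightarrow>\<^sub>E points B. \<forall>g\<in>carrier \<Gamma>. \<forall>\<omega>\<in>points A. f (act A g \<omega>) = act B g (f \<omega>)}"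

definition monodromy_group ::
  "('g, 'c) monoid_scheme \<Rightarrow> ('g, 'p) perm_obj \<Rightarrow> ('p \<Rightarrow> 'p) set" where
  "monodromy_group \<Gamma> A = act A ` carrier \<Gamma>"

definition perm_connected :: "('g, 'c) monoid_scheme \<Rightarrow> ('g, 'p) perm_obj \<Rightarrow> bool" where
  "perm_connected \<Gamma> A \<longleftrightarrow> points A \<noteq> {} \<and>
    (\<forall>\<alpha>\<in>points A. \<forall>\<beta>\<in>points A. \<exists>g\<in>carrier \<Gamma>. act A g \<alpha> = \<beta>)"

definition AutC :: "('g, 'c) monoid_scheme \<Rightarrow> ('g, 'p) perm_obj \<Rightarrow> ('p \<Rightarrow> 'p) monoid" where
  "AutC \<Gamma> A = (SymR (points A))\<lparr>carrier := perm_morphisms \<Gamma> A A \<inter> Bij (points A)\<rparr>"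

definition min_regular_cover ::
  "('g, 'c) monoid_scheme \<Rightarrow> ('g, 'p) perm_obj \<Rightarrow> ('g, 'p \<Rightarrow> 'p) perm_obj" where
  "min_regular_cover \<Gamma> A =
    \<lparr>points = monodromy_group \<Gamma> A,
     act = (\<lambda>g. \<lambda>h\<in>monodromy_group \<Gamma> A. h \<otimes>\<^bsub>SymR (points A)\<^esub> act A g)\<rparr>"

lemma SymR_simps:
  "carrier (SymR \<Omega>) = Bij \<Omega>"
  "\<one>\<^bsub>SymR \<Omega>\<^esub> = (\<lambda>\<omega>\<in>\<Omega>. \<omega>)"
  "f \<in> Bij \<Omega> \<Longrightarrow> g \<in> Bij \<Omega> \<Longrightarrow> f \<otimes>\<^bsub>SymR \<Omega>\<^esub> g = compose \<Omega> g f"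
  by (simp_all add: SymR_def BijGroup_def)

lemma group_SymR: "group (SymR \<Omega>)"
proof (rule groupI)
  interpret B: group "BijGroup \<Omega>" by (rule group_BijGroup)
  fix x assume x: "x \<in> carrier (SymR \<Omega>)"
  then have "x \<in> carrier (BijGroup \<Omega>)" by (simp add: SymR_def)
  then show "\<exists>y\<in>carrier (SymR \<Omega>). y \<otimes>\<^bsub>SymR \<Omega>\<^esub> x = \<one>\<^bsub>SymR \<Omega>\<^esub>"
    by (intro bexI[of _ "inv\<^bsub>BijGroup \<Omega>\<^esub> x"]) (simp_all add: SymR_def)
  show "\<one>\<^bsub>SymR \<Omega>\<^esub> \<otimes>\<^bsub>SymR \<Omega>\<^esub> x = x"
    using \<open>x \<in> carrier (BijGroup \<Omega>)\<close> by (simp add: SymR_def)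
next
  interpret B: group "BijGroup \<Omega>" by (rule group_BijGroup)
  show "\<And>x y z. \<lbrakk>x \<in> carrier (SymR \<Omega>); y \<in> carrier (SymR \<Omega>); z \<in> carrier (SymR \<Omega>)\<rbrakk>
    \<Longrightarrow> x \<otimes>\<^bsub>SymR \<Omega>\<^esub> y \<otimes>\<^bsub>SymR \<Omega>\<^esub> z = x \<otimes>\<^bsub>SymR \<Omega>\<^esub> (y \<otimes>\<^bsub>SymR \<Omega>\<^esub> z)"
    by (simp add: SymR_def B.m_assoc)
  show "\<And>x y. \<lbrakk>x \<in> carrier (SymR \<Omega>); y \<in> carrier (SymR \<Omega>)\<rbrakk>
    \<Longrightarrow> x \<otimes>\<^bsub>SymR \<Omega>\<^esub> y \<in> carrier (SymR \<Omega>)"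
    by (simp add: SymR_def)
  show "\<one>\<^bsub>SymR \<Omega>\<^esub> \<in> carrier (SymR \<Omega>)"
    by (simp add: SymR_def)
qed

lemma monodromy_subgroup:
  assumes "group \<Gamma>" "is_perm_obj \<Gamma> A"
  shows "subgroup (monodromy_group \<Gamma> A) (SymR (points A))"
proof -
  interpret h: group_hom \<Gamma> "SymR (points A)" "act A"
    using assms by (simp add: group_hom_def group_hom_axioms_def group_SymR is_perm_obj_def)
  show ?thesis
    unfolding monodromy_group_def by (rule h.img_is_subgroup)
qed

lemma min_regular_cover_is_perm_obj:
  assumes "group \<Gamma>" "is_perm_obj \<Gamma> A"
  shows "is_perm_obj \<Gamma> (min_regular_cover \<Gamma> A)"
proof -
  interpret \<Gamma>: group \<Gamma> by fact
  interpret S: group "SymR (points A)" by (rule group_SymR)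
  let ?M = "monodromy_group \<Gamma> A"
  let ?r = "\<lambda>g. \<lambda>h\<in>?M. h \<otimes>\<^bsub>SymR (points A)\<^esub> act A g"
  interpret M: subgroup ?M "SymR (points A)" using assms by (rule monodromy_subgroup)
  have act: "act A g \<in> ?M" if "g \<in> carrier \<Gamma>" for g
    using that by (simp add: monodromy_group_def)
  have bij: "?r g \<in> Bij ?M" if g: "g \<in> carrier \<Gamma>" for g
  proof -
    have "bij_betw (?r g) ?M ?M"
      by (rule bij_betwI[of _ _ _ "\<lambda>h. h \<otimes>\<^bsub>SymR (points A)\<^esub> inv\<^bsub>SymR (points A)\<^esub> act A g"])
        (use act[OF g] in \<open>auto simp: S.m_assoc S.r_inv S.l_inv M.mem_carrier\<close>)
    then show ?thesis by (simp add: Bij_def)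
  qed
  have "?r (g \<otimes>\<^bsub>\<Gamma>\<^esub> h) = ?r g \<otimes>\<^bsub>SymR ?M\<^esub> ?r h" if "g \<in> carrier \<Gamma>" "h \<in> carrier \<Gamma>" for g h
  proof -
    have "act A (g \<otimes>\<^bsub>\<Gamma>\<^esub> h) = act A g \<otimes>\<^bsub>SymR (points A)\<^esub> act A h"
      using assms(2) that by (simp add: is_perm_obj_def hom_mult)
    then show ?thesis
      using act[OF that(1)] act[OF that(2)]
      by (subst SymR_simps(3)[OF bij[OF that(1)] bij[OF that(2)]])
        (rule ext, simp add: compose_def S.m_assoc M.mem_carrier)
  qed
  with bij show ?thesis
    unfolding is_perm_obj_def min_regular_cover_def perm_obj.simps
    by (intro homI) (simp_all only: SymR_simps(1))
qed

lemma AutC_subgroup: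
  assumes "group \<Gamma>" "is_perm_obj \<Gamma> A"
  shows "subgroup (carrier (AutC \<Gamma> A)) (SymR (points A))"
proof -
  interpret S: group "SymR (points A)" by (rule group_SymR)
  have actB: "act A g \<omega> \<in> points A" if "g \<in> carrier \<Gamma>" "\<omega> \<in> points A" for g \<omega>
  proof -
    have "act A g \<in> Bij (points A)"
      using assms(2) that(1) by (metis is_perm_obj_def hom_in_carrier SymR_simps(1))
    then show ?thesis using that(2) Bij_imp_funcset by blast
  qed
  have aut: "f \<in> carrier (AutC \<Gamma> A) \<longleftrightarrow>
      f \<in> Bij (points A) \<and> (\<forall>g\<in>carrier \<Gamma>. \<forall>\<omega>\<in>points A. f (act A g \<omega>) = act A g (f \<omega>))" for f
    by (auto simp: AutC_def perm_morphisms_def PiE_def Bij_imp_extensional dest: Bij_imp_funcset)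
  show ?thesis
  proof (rule S.subgroupI)
    show "carrier (AutC \<Gamma> A) \<subseteq> carrier (SymR (points A))"
      by (auto simp: aut SymR_simps)
    have "(\<lambda>\<omega>\<in>points A. \<omega>) \<in> carrier (AutC \<Gamma> A)"
      by (auto simp: aut id_Bij actB)
    then show "carrier (AutC \<Gamma> A) \<noteq> {}" by blast
  next
    fix f assume f: "f \<in> carrier (AutC \<Gamma> A)"
    let ?i = "\<lambda>\<omega>\<in>points A. inv_into (points A) f \<omega>"
    have fB: "f \<in> Bij (points A)" using f by (simp add: aut)
    have iB: "?i \<in> Bij (points A)" by (rule restrict_inv_into_Bij[OF fB])
    have "f \<otimes>\<^bsub>SymR (points A)\<^esub> ?i = \<one>\<^bsub>SymR (points A)\<^esub>"
      using fB iB by (simp add: SymR_simps Bij_compose_restrict_eq)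
    then have inv: "inv\<^bsub>SymR (points A)\<^esub> f = ?i"
      using fB iB S.inv_equality by (metis S.inv_inv SymR_simps(1))
    have bb: "bij_betw f (points A) (points A)" using fB by (simp add: Bij_def)
    have "?i (act A g \<omega>) = act A g (?i \<omega>)" if g: "g \<in> carrier \<Gamma>" and w: "\<omega> \<in> points A" for g \<omega>
    proof -
      obtain \<alpha> where a: "\<alpha> \<in> points A" "\<omega> = f \<alpha>"
        using bb w by (auto simp: bij_betw_def)
      have "f (act A g \<alpha>) = act A g \<omega>" using f g a by (simp add: aut)
      then show ?thesis
        using a g w actB bb by (metis bij_betw_inv_into_left restrict_apply')
    qed
    with iB show "inv\<^bsub>SymR (points A)\<^esub> f \<in> carrier (AutC \<Gamma> A)"
      by (simp only: inv aut) blast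
  next
    fix f h assume fh: "f \<in> carrier (AutC \<Gamma> A)" "h \<in> carrier (AutC \<Gamma> A)"
    then have B: "f \<in> Bij (points A)" "h \<in> Bij (points A)" by (simp_all add: aut)
    then have "f \<omega> \<in> points A" if "\<omega> \<in> points A" for \<omega> using that Bij_imp_funcset by blast
    then show "f \<otimes>\<^bsub>SymR (points A)\<^esub> h \<in> carrier (AutC \<Gamma> A)"
      using fh B by (auto simp: SymR_simps aut compose_Bij compose_eq actB)
  qed
qed

lemma group_AutC:
  assumes "group \<Gamma>" "is_perm_obj \<Gamma> A"
  shows "group (AutC \<Gamma> A)"
proof -
  have "AutC \<Gamma> A = (SymR (points A))\<lparr>carrier := carrier (AutC \<Gamma> A)\<rparr>"
    by (simp add: AutC_def)
  then show ?thesis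
    using group.subgroup_imp_group[OF group_SymR AutC_subgroup[OF assms]] by simp
qed


section \<open>Oriented maps and hypermaps\<close>

datatype xyz = GenX | GenY | GenZ

definition map_relators :: "xyz word set" where
  "map_relators = {[(GenY, True), (GenY, True)], [(GenX, True), (GenY, True), (GenZ, True)]}"

definition hypermap_relators :: "xyz word set" where
  "hypermap_relators = {[(GenX, True), (GenY, True), (GenZ, True)]}"

definition Delta_map :: "xyz word set monoid" where
  "Delta_map = presented_group map_relators"

definition Delta_hypermap :: "xyz word set monoid" where
  "Delta_hypermap = presented_group hypermap_relators"

definition xperm :: "int \<Rightarrow> int" where
  "xperm = (\<lambda>i. i + 1)"

definition yperm :: "int \<Rightarrow> int" where
  "yperm = transpose 0 1"

definition Pgroup :: "(int \<Rightarrow> int) set" where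
  "Pgroup = generate (SymR UNIV) {xperm, yperm}"

text \<open>The value at \<open>Z\<close> is forced by the relator \<open>XYZ\<close>.\<close>

fun xyz_perm :: "xyz \<Rightarrow> int \<Rightarrow> int" where
  "xyz_perm GenX = xperm"
| "xyz_perm GenY = yperm"
| "xyz_perm GenZ = inv\<^bsub>SymR UNIV\<^esub> (xperm \<otimes>\<^bsub>SymR UNIV\<^esub> yperm)"

definition M_infinity :: "(xyz word set, int) perm_obj" where
  "M_infinity = \<lparr>points = UNIV, act = induced_hom (SymR UNIV) xyz_perm\<rparr>"

definition H_infinity :: "(xyz word set, int) perm_obj" where
  "H_infinity = \<lparr>points = UNIV, act = induced_hom (SymR UNIV) xyz_perm\<rparr>"

abbreviation M_infinity_cover :: "(xyz word set, int \<Rightarrow> int) perm_obj" where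
  "M_infinity_cover \<equiv> min_regular_cover Delta_map M_infinity"

abbreviation H_infinity_cover :: "(xyz word set, int \<Rightarrow> int) perm_obj" where
  "H_infinity_cover \<equiv> min_regular_cover Delta_hypermap H_infinity"

lemma xperm_Bij: "xperm \<in> Bij UNIV"
  unfolding Bij_def xperm_def by (auto intro!: bij_betwI[of _ _ _ "\<lambda>i. i - 1"])

lemma yperm_Bij: "yperm \<in> Bij UNIV"
  by (simp add: Bij_def yperm_def)

lemma xyz_perm_closed: "range xyz_perm \<subseteq> carrier (SymR UNIV)"
proof -
  interpret S: group "SymR (UNIV :: int set)" by (rule group_SymR)
  have "xperm \<in> carrier (SymR UNIV)" "yperm \<in> carrier (SymR UNIV)"
    by (simp_all add: SymR_simps xperm_Bij yperm_Bij)
  then have "xyz_perm g \<in> carrier (SymR UNIV)" for g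
    by (cases g) auto
  then show ?thesis by blast
qed

lemma xyz_perm_map_relators:
  assumes "r \<in> map_relators"
  shows "word_value (SymR UNIV) xyz_perm r = \<one>\<^bsub>SymR UNIV\<^esub>"
proof -
  interpret S: group "SymR (UNIV :: int set)" by (rule group_SymR)
  have xy: "xperm \<in> carrier (SymR UNIV)" "yperm \<in> carrier (SymR UNIV)"
    by (simp_all add: SymR_simps xperm_Bij yperm_Bij)
  have "yperm \<otimes>\<^bsub>SymR UNIV\<^esub> yperm = \<one>\<^bsub>SymR UNIV\<^esub>"
    by (simp add: SymR_simps yperm_Bij compose_def) (simp add: yperm_def restrict_def)
  moreover have "xperm \<otimes>\<^bsub>SymR UNIV\<^esub> (yperm \<otimes>\<^bsub>SymR UNIV\<^esub> xyz_perm GenZ) = \<one>\<^bsub>SymR UNIV\<^esub>"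
    using xy by (simp flip: S.m_assoc)
  moreover have "xyz_perm GenZ \<in> carrier (SymR UNIV)"
    using xyz_perm_closed by blast
  ultimately show ?thesis
    using assms xy by (auto simp: map_relators_def simp del: xyz_perm.simps(3))
qed

lemma xyz_perm_hypermap_relators:
  "r \<in> hypermap_relators \<Longrightarrow> word_value (SymR UNIV) xyz_perm r = \<one>\<^bsub>SymR UNIV\<^esub>"
  by (rule xyz_perm_map_relators) (simp add: map_relators_def hypermap_relators_def)

lemma group_Delta_map: "group Delta_map"
  and group_Delta_hypermap: "group Delta_hypermap"
  by (simp_all add: Delta_map_def Delta_hypermap_def presented_group_is_group)

lemma M_infinity_is_perm_obj: "is_perm_obj Delta_map M_infinity"
  unfolding is_perm_obj_def Delta_map_def M_infinity_def perm_obj.simps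
  by (rule group.induced_hom_in_hom[OF group_SymR xyz_perm_closed xyz_perm_map_relators])

lemma H_infinity_is_perm_obj: "is_perm_obj Delta_hypermap H_infinity"
  unfolding is_perm_obj_def Delta_hypermap_def H_infinity_def perm_obj.simps
  by (rule group.induced_hom_in_hom[OF group_SymR xyz_perm_closed xyz_perm_hypermap_relators])

lemma M_infinity_gens:
  "act M_infinity (pres_gen map_relators GenX) = xperm"
  "act M_infinity (pres_gen map_relators GenY) = yperm"
  by (simp_all add: M_infinity_def
      group.induced_hom_gen[OF group_SymR xyz_perm_closed xyz_perm_map_relators])

lemma H_infinity_gens:
  "act H_infinity (pres_gen hypermap_relators GenX) = xperm"
  "act H_infinity (pres_gen hypermap_relators GenY) = yperm"
  by (simp_all add: H_infinity_def
      group.induced_hom_gen[OF group_SymR xyz_perm_closed xyz_perm_hypermap_relators])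

lemma generate_xyz_perm: "generate (SymR UNIV) (range xyz_perm) = Pgroup"
proof
  interpret S: group "SymR (UNIV :: int set)" by (rule group_SymR)
  have xy: "{xperm, yperm} \<subseteq> carrier (SymR UNIV)"
    by (simp add: SymR_simps xperm_Bij yperm_Bij)
  have sub: "subgroup Pgroup (SymR UNIV)"
    unfolding Pgroup_def by (rule S.generate_is_subgroup[OF xy])
  have "xperm \<in> Pgroup" "yperm \<in> Pgroup"
    by (simp_all add: Pgroup_def generate.incl)
  then have "xyz_perm g \<in> Pgroup" for g
    using sub by (cases g) (auto intro: subgroup.m_closed subgroup.m_inv_closed)
  then show "generate (SymR UNIV) (range xyz_perm) \<subseteq> Pgroup"
    by (intro S.generate_subgroup_incl[OF _ sub]) blast
  have "{xperm, yperm} \<subseteq> range xyz_perm"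
    by (metis empty_subsetI insert_subset rangeI xyz_perm.simps(1,2))
  then show "Pgroup \<subseteq> generate (SymR UNIV) (range xyz_perm)"
    unfolding Pgroup_def by (rule S.mono_generate)
qed

lemma monodromy_M_infinity: "monodromy_group Delta_map M_infinity = Pgroup"
  unfolding monodromy_group_def Delta_map_def M_infinity_def perm_obj.simps
  using group.induced_hom_image[OF group_SymR xyz_perm_closed xyz_perm_map_relators]
  by (simp add: generate_xyz_perm)

lemma monodromy_H_infinity: "monodromy_group Delta_hypermap H_infinity = Pgroup"
  unfolding monodromy_group_def Delta_hypermap_def H_infinity_def perm_obj.simps
  using group.induced_hom_image[OF group_SymR xyz_perm_closed xyz_perm_hypermap_relators]
  by (simp add: generate_xyz_perm)

lemma Pgroup_transitive: "\<exists>p\<in>Pgroup. p i = j"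
proof -
  interpret S: group "SymR (UNIV :: int set)" by (rule group_SymR)
  have xy: "{xperm, yperm} \<subseteq> carrier (SymR UNIV)"
    by (simp add: SymR_simps xperm_Bij yperm_Bij)
  have sub: "subgroup Pgroup (SymR UNIV)"
    unfolding Pgroup_def by (rule S.generate_is_subgroup[OF xy])
  have shift: "(\<lambda>i. i + int n) \<in> Pgroup" for n
  proof (induction n)
    case 0
    then show ?case using subgroup.one_closed[OF sub] by (simp add: SymR_simps restrict_def)
  next
    case (Suc n)
    have x: "xperm \<in> Pgroup" by (simp add: Pgroup_def generate.incl)
    have "(\<lambda>i. i + int n) \<in> Bij UNIV"
      using subgroup.mem_carrier[OF sub Suc] by (simp add: SymR_simps)
    then have "(\<lambda>i. i + int n) \<otimes>\<^bsub>SymR UNIV\<^esub> xperm = (\<lambda>i. i + int (Suc n))"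
      by (simp add: SymR_simps xperm_Bij compose_def restrict_def) (simp add: xperm_def ac_simps)
    then show ?case using subgroup.m_closed[OF sub Suc x] by simp
  qed
  show ?thesis
  proof (cases "i \<le> j")
    case True
    then show ?thesis using shift[of "nat (j - i)"] by (intro bexI) auto
  next
    case False
    let ?s = "\<lambda>k. k + int (nat (i - j))"
    have s: "?s \<in> Bij UNIV"
      using subgroup.mem_carrier[OF sub shift[of "nat (i - j)"]] by (simp only: SymR_simps)
    let ?t = "inv\<^bsub>SymR UNIV\<^esub> ?s"
    have tP: "?t \<in> Pgroup" using subgroup.m_inv_closed[OF sub shift] .
    have t: "?t \<in> Bij UNIV" using subgroup.mem_carrier[OF sub tP] by (simp add: SymR_simps)
    have "?s \<otimes>\<^bsub>SymR UNIV\<^esub> ?t = \<one>\<^bsub>SymR UNIV\<^esub>"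
      using s by (simp add: SymR_simps S.r_inv)
    then have "compose UNIV ?t ?s = (\<lambda>k. k)"
      using s t by (simp add: SymR_simps restrict_def)
    then have "?t (?s j) = j" by (metis UNIV_I compose_eq)
    then show ?thesis using False tP by (intro bexI[of _ ?t]) auto
  qed
qed

lemma M_infinity_connected: "perm_connected Delta_map M_infinity"
proof -
  have "\<exists>p\<in>monodromy_group Delta_map M_infinity. p i = j" for i j
    by (simp only: monodromy_M_infinity Pgroup_transitive)
  then show ?thesis
    by (auto simp: perm_connected_def monodromy_group_def M_infinity_def)
qed

lemma H_infinity_connected: "perm_connected Delta_hypermap H_infinity"
proof -
  have "\<exists>p\<in>monodromy_group Delta_hypermap H_infinity. p i = j" for i j
    by (simp only: monodromy_H_infinity Pgroup_transitive)
  then show ?thesis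
    by (auto simp: perm_connected_def monodromy_group_def H_infinity_def)
qed

end

theory Submission
  imports Defs "HOL-Combinatorics.Permutations"
begin

text \<open>
  Both covers are the same group \<open>P\<close>, acted on by its own right multiplications: their parent
  groups have different presentations but the same image in the symmetric group of the integers.
  A permutation commuting with all generators' actions therefore commutes with the same family of
  maps in either category, so the two automorphism groups coincide (\<open>AutC_min_regular_cover\<close>
  describes them without reference to the parent group). Left multiplications commute with
  right multiplications, so \<open>P\<close> embeds in this automorphism group (\<open>left_mult_hom_AutC\<close>,
  \<open>inj_on_left_mult\<close>).

  It remains to embed a finite group \<open>G\<close> in \<open>P\<close>. Conjugating the transposition \<open>y\<close> by powers of
  the shift \<open>x\<close> gives all transpositions of neighbours, and these generate every permutation of
  finite support (\<open>finite_support_in_Pgroup\<close>). By Cayley's theorem \<open>G\<close> acts faithfully on a set of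
  \<open>card G\<close> integers, hence by permutations of finite support
  (\<open>finite_group_embeds_in_Pgroup\<close>).
\<close>

section \<open>Automorphisms of a minimal regular cover\<close>

text \<open>
  The action on the cover enters only through the elements of the monodromy group that it
  multiplies by, so the parent group disappears from the description. This is what makes objects
  of different permutational categories comparable.
\<close>

lemma AutC_min_regular_cover:
  assumes "group \<Gamma>" "is_perm_obj \<Gamma> A"
  shows "AutC \<Gamma> (min_regular_cover \<Gamma> A) =
    (SymR (monodromy_group \<Gamma> A))\<lparr>carrier := {f \<in> Bij (monodromy_group \<Gamma> A).
       \<forall>p\<in>monodromy_group \<Gamma> A. \<forall>h\<in>monodromy_group \<Gamma> A.
         f (h \<otimes>\<^bsub>SymR (points A)\<^esub> p) = f h \<otimes>\<^bsub>SymR (points A)\<^esub> p}\<rparr>"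
proof -
  let ?M = "monodromy_group \<Gamma> A"
  have "perm_morphisms \<Gamma> (min_regular_cover \<Gamma> A) (min_regular_cover \<Gamma> A) \<inter> Bij ?M =
    {f \<in> Bij ?M. \<forall>p\<in>?M. \<forall>h\<in>?M.
       f (h \<otimes>\<^bsub>SymR (points A)\<^esub> p) = f h \<otimes>\<^bsub>SymR (points A)\<^esub> p}"
    (is "?L = ?R")
  proof (rule Set.set_eqI)
    fix f
    show "f \<in> ?L \<longleftrightarrow> f \<in> ?R"
    proof (cases "f \<in> Bij ?M")
      case True
      then have f: "f \<in> ?M \<rightarrow>\<^sub>E ?M"
        by (auto simp: PiE_def Bij_imp_extensional dest: Bij_imp_funcset)
      then have "f h \<in> ?M" if "h \<in> ?M" for h
        using that by blast
      with True f show ?thesis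
        by (auto simp: perm_morphisms_def min_regular_cover_def monodromy_group_def)
    qed simp
  qed
  then show ?thesis
    by (simp add: AutC_def) (simp add: min_regular_cover_def)
qed

text \<open>The inverse makes the map multiplicative for permutations composed from left to right:
  multiplying by the inverse of \<open>p\<close>, and then by that of \<open>q\<close>, is multiplying by the inverse of
  \<open>p \<otimes> q\<close>.\<close>

definition left_mult :: "('a, 'b) monoid_scheme \<Rightarrow> 'a set \<Rightarrow> 'a \<Rightarrow> 'a \<Rightarrow> 'a" where
  "left_mult S M p = (\<lambda>h\<in>M. inv\<^bsub>S\<^esub> p \<otimes>\<^bsub>S\<^esub> h)"

context group
begin

lemma left_mult_Bij:
  assumes "subgroup M G" "p \<in> M"
  shows "left_mult G M p \<in> Bij M"
proof -
  interpret M: subgroup M G by fact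
  have "bij_betw (left_mult G M p) M M"
    by (rule bij_betwI[of _ _ _ "\<lambda>h. p \<otimes> h"])
      (use assms(2) in \<open>auto simp: left_mult_def M.mem_carrier simp flip: m_assoc\<close>)
  then show ?thesis by (simp add: Bij_def left_mult_def)
qed

lemma left_mult_mult:
  assumes "subgroup M G" "p \<in> M" "q \<in> M"
  shows "left_mult G M (p \<otimes> q) = left_mult G M p \<otimes>\<^bsub>SymR M\<^esub> left_mult G M q"
proof -
  interpret M: subgroup M G by fact
  show ?thesis
    using assms(2,3)
    by (subst SymR_simps(3)[OF left_mult_Bij left_mult_Bij])
      (auto intro!: M.subgroup_axioms ext
        simp: compose_def left_mult_def M.mem_carrier inv_mult_group m_assoc)
qed

lemma inj_on_left_mult:
  assumes "subgroup M G"
  shows "inj_on (left_mult G M) M"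
proof (rule inj_onI)
  interpret M: subgroup M G by fact
  fix p q assume pq: "p \<in> M" "q \<in> M" "left_mult G M p = left_mult G M q"
  then have "left_mult G M p \<one> = left_mult G M q \<one>" by simp
  with pq(1,2) have "inv p = inv q" by (simp add: left_mult_def M.mem_carrier)
  with pq show "p = q" by (metis M.mem_carrier inv_inv)
qed

end

text \<open>By associativity, left multiplications commute with the right multiplications that make up
  the action on the cover.\<close>

lemma left_mult_hom_AutC:
  assumes "group \<Gamma>" "is_perm_obj \<Gamma> A"
  shows "left_mult (SymR (points A)) (monodromy_group \<Gamma> A)
    \<in> hom ((SymR (points A))\<lparr>carrier := monodromy_group \<Gamma> A\<rparr>) (AutC \<Gamma> (min_regular_cover \<Gamma> A))"
proof -
  interpret S: group "SymR (points A)" by (rule group_SymR)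
  have sub: "subgroup (monodromy_group \<Gamma> A) (SymR (points A))"
    using assms by (rule monodromy_subgroup)
  interpret M: subgroup "monodromy_group \<Gamma> A" "SymR (points A)" by (rule sub)
  show ?thesis
    unfolding AutC_min_regular_cover[OF assms]
    by (rule homI)
      (auto simp: S.left_mult_Bij[OF sub] S.left_mult_mult[OF sub],
       auto simp: left_mult_def S.m_assoc M.mem_carrier)
qed

section \<open>Permutations of finite support\<close>

lemma subgroup_Pgroup: "subgroup Pgroup (SymR UNIV)"
  unfolding Pgroup_def
  by (rule group.generate_is_subgroup[OF group_SymR])
    (simp add: SymR_simps xperm_Bij yperm_Bij)

lemma mult_SymR_UNIV:
  assumes "bij f" "bij g"
  shows "f \<otimes>\<^bsub>SymR UNIV\<^esub> g = g \<circ> f"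
  using assms by (simp add: SymR_simps Bij_def compose_def comp_def restrict_def)

lemma Pgroup_bij: "p \<in> Pgroup \<Longrightarrow> bij p"
  using subgroup.mem_carrier[OF subgroup_Pgroup] by (force simp: SymR_simps Bij_def)

lemma Pgroup_comp: "p \<in> Pgroup \<Longrightarrow> q \<in> Pgroup \<Longrightarrow> p \<circ> q \<in> Pgroup"
  using subgroup.m_closed[OF subgroup_Pgroup, of q p] by (simp add: mult_SymR_UNIV Pgroup_bij)

lemma Pgroup_id: "id \<in> Pgroup"
  using subgroup.one_closed[OF subgroup_Pgroup] by (simp add: SymR_simps restrict_def id_def)

lemma Pgroup_inv: "inv_into UNIV p \<in> Pgroup" if "p \<in> Pgroup"
proof -
  interpret S: group "SymR (UNIV :: int set)" by (rule group_SymR)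
  let ?q = "inv\<^bsub>SymR UNIV\<^esub> p"
  have q: "?q \<in> Pgroup" using subgroup.m_inv_closed[OF subgroup_Pgroup that] .
  have one: "\<one>\<^bsub>SymR UNIV\<^esub> = (id :: int \<Rightarrow> int)"
    by (simp add: SymR_simps restrict_def id_def)
  note p = subgroup.mem_carrier[OF subgroup_Pgroup that]
  have "p \<circ> ?q = id" "?q \<circ> p = id"
    using S.l_inv[OF p] S.r_inv[OF p]
    by (simp_all only: mult_SymR_UNIV Pgroup_bij[OF that] Pgroup_bij[OF q] one)
  then have "inv_into UNIV p = ?q"
    by (rule inv_unique_comp)
  with q show ?thesis by simp
qed

lemma transpose_conj:
  assumes "bij p"
  shows "p \<circ> transpose a b \<circ> inv_into UNIV p = transpose (p a) (p b)"
proof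
  fix i
  obtain k where "i = p k"
    using assms by (metis bij_pointE)
  then show "(p \<circ> transpose a b \<circ> inv_into UNIV p) i = transpose (p a) (p b) i"
    using assms by (auto simp: transpose_def bij_is_inj inj_eq)
qed

lemma transpose_conj_in_Pgroup:
  assumes "p \<in> Pgroup" "transpose a b \<in> Pgroup"
  shows "transpose (p a) (p b) \<in> Pgroup"
  using transpose_conj[OF Pgroup_bij[OF assms(1)]] assms by (metis Pgroup_comp Pgroup_inv)

text \<open>Conjugating by the shift and by its inverse moves the transposition \<open>(0, 1)\<close> along the whole
  line.\<close>

lemma transpose_neighbours_in_Pgroup: "transpose k (k + 1) \<in> Pgroup"
proof -
  have x: "xperm \<in> Pgroup" and y: "yperm \<in> Pgroup"
    by (simp_all add: Pgroup_def generate.incl)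
  have inv_x: "inv_into UNIV xperm i = i - 1" for i
    by (rule inv_f_eq[OF bij_is_inj[OF Pgroup_bij[OF x]]]) (simp add: xperm_def)
  show ?thesis
  proof (induction k rule: int_induct[where k = 0])
    case base
    then show ?case using y by (simp add: yperm_def)
  next
    case (step1 i)
    then show ?case using transpose_conj_in_Pgroup[OF x, of i "i + 1"] by (simp add: xperm_def)
  next
    case (step2 i)
    then show ?case using transpose_conj_in_Pgroup[OF Pgroup_inv[OF x], of i "i + 1"]
      by (simp add: inv_x)
  qed
qed

lemma transpose_in_Pgroup: "transpose (a :: int) b \<in> Pgroup"
proof -
  have up: "transpose a (a + int n) \<in> Pgroup" for a n
  proof (induction n)
    case 0
    then show ?case using Pgroup_id by (simp add: id_def)
  next
    case (Suc n)
    show ?case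
    proof (cases "n = 0")
      case True
      then show ?thesis using transpose_neighbours_in_Pgroup by simp
    next
      \<comment> \<open>Conjugation by the transposition of \<open>a + n\<close> and \<open>a + n + 1\<close> moves only the far endpoint;
        it would also move \<open>a\<close> if \<open>n\<close> were zero.\<close>
      case False
      then show ?thesis
        using transpose_conj_in_Pgroup[OF transpose_neighbours_in_Pgroup[of "a + int n"] Suc]
        by (simp add: ac_simps)
    qed
  qed
  show ?thesis
    using up[of a "nat (b - a)"] up[of b "nat (a - b)"]
    by (cases "a \<le> b") (simp_all add: transpose_commute)
qed

lemma finite_support_in_Pgroup:
  assumes "p permutes S" "finite S"
  shows "p \<in> Pgroup"
  using assms(2,1)
  by (induction rule: permutes_rev_induct) (blast intro: Pgroup_id Pgroup_comp transpose_in_Pgroup)+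

section \<open>Finite groups as automorphism groups\<close>

text \<open>Cayley's theorem, with the elements of \<open>G\<close> numbered by integers. Right multiplications are
  used because products in \<open>SymR\<close> compose from left to right.\<close>

lemma finite_group_embeds_in_Pgroup:
  assumes "group G" "finite (carrier G)"
  shows "\<exists>\<phi>. \<phi> \<in> hom G ((SymR UNIV)\<lparr>carrier := Pgroup\<rparr>) \<and> inj_on \<phi> (carrier G)"
proof -
  interpret G: group G by fact
  obtain e :: "'a \<Rightarrow> nat" where "inj_on e (carrier G)"
    using finite_imp_inj_to_nat_seg[OF assms(2)] by blast
  then have e: "inj_on (int \<circ> e) (carrier G)"
    by (auto intro: comp_inj_on)
  let ?e = "int \<circ> e"
  let ?S = "?e ` carrier G"
  let ?d = "inv_into (carrier G) ?e"
  define \<phi> where "\<phi> g i = (if i \<in> ?S then ?e (?d i \<otimes>\<^bsub>G\<^esub> g) else i)" for g i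
  have \<phi>_e: "\<phi> g (?e h) = ?e (h \<otimes>\<^bsub>G\<^esub> g)" if "h \<in> carrier G" for g h
    using that inv_into_f_f[OF e that] by (simp add: \<phi>_def)
  have \<phi>_fix: "\<phi> g i = i" if "i \<notin> ?S" for g i
    unfolding \<phi>_def using that by (rule if_not_P)
  have mult: "\<phi> h \<circ> \<phi> g = \<phi> (g \<otimes>\<^bsub>G\<^esub> h)" if "g \<in> carrier G" "h \<in> carrier G" for g h
  proof
    fix i
    show "(\<phi> h \<circ> \<phi> g) i = \<phi> (g \<otimes>\<^bsub>G\<^esub> h) i"
    proof (cases "i \<in> ?S")
      case True
      then obtain k where k: "k \<in> carrier G" "i = ?e k" by blast
      with that show ?thesis
        by (simp only: comp_apply[of "\<phi> h"] \<phi>_e G.m_closed G.m_assoc)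
    next
      case False
      then show ?thesis by (simp only: comp_apply[of "\<phi> h"] \<phi>_fix[OF False])
    qed
  qed
  have one: "\<phi> \<one>\<^bsub>G\<^esub> = id"
  proof
    fix i
    show "\<phi> \<one>\<^bsub>G\<^esub> i = id i"
    proof (cases "i \<in> ?S")
      case True
      then obtain k where k: "k \<in> carrier G" "i = ?e k" by blast
      then show ?thesis by (simp only: \<phi>_e G.r_one id_apply)
    next
      case False
      then show ?thesis by (simp only: \<phi>_fix[OF False] id_apply)
    qed
  qed
  have bij: "bij (\<phi> g)" if "g \<in> carrier G" for g
    using mult[OF that G.inv_closed[OF that]] mult[OF G.inv_closed[OF that] that] that
    by (intro o_bij[of "\<phi> (inv\<^bsub>G\<^esub> g)"]) (simp_all only: G.r_inv G.l_inv one)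
  have P: "\<phi> g \<in> Pgroup" if "g \<in> carrier G" for g
  proof (rule finite_support_in_Pgroup)
    show "\<phi> g permutes ?S"
      using bij[OF that] \<phi>_fix unfolding bij_iff permutes_def by blast
  qed (use assms(2) in blast)
  have "\<phi> \<in> hom G ((SymR UNIV)\<lparr>carrier := Pgroup\<rparr>)"
    by (rule homI) (simp_all add: P mult_SymR_UNIV bij mult)
  moreover have "inj_on \<phi> (carrier G)"
  proof (rule inj_onI)
    fix g h assume gh: "g \<in> carrier G" "h \<in> carrier G" "\<phi> g = \<phi> h"
    then have "\<phi> g (?e \<one>\<^bsub>G\<^esub>) = \<phi> h (?e \<one>\<^bsub>G\<^esub>)" by simp
    with gh(1,2) have "?e g = ?e h" by (simp only: \<phi>_e G.one_closed G.l_one)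
    then show "g = h" using gh(1,2) by (rule inj_onD[OF e])
  qed
  ultimately show ?thesis by blast
qed

theorem proposition21:
  shows "AutC Delta_map M_infinity_cover = AutC Delta_hypermap H_infinity_cover \<and>
    (\<forall>G :: ('a, 'b) monoid_scheme. group G \<and> finite (carrier G) \<longrightarrow>
      (\<exists>K. subgroup K (AutC Delta_map M_infinity_cover) \<and>
        G \<cong> (AutC Delta_map M_infinity_cover)\<lparr>carrier := K\<rparr>))"
proof (intro conjI allI impI)
  have pts: "points M_infinity = UNIV" "points H_infinity = UNIV"
    by (simp_all add: M_infinity_def H_infinity_def)
  show "AutC Delta_map M_infinity_cover = AutC Delta_hypermap H_infinity_cover"
    by (simp only: AutC_min_regular_cover[OF group_Delta_map M_infinity_is_perm_obj]
        AutC_min_regular_cover[OF group_Delta_hypermap H_infinity_is_perm_obj]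
        monodromy_M_infinity monodromy_H_infinity pts)
  fix G :: "('a, 'b) monoid_scheme"
  assume G: "group G \<and> finite (carrier G)"
  let ?A = "AutC Delta_map M_infinity_cover"
  let ?L = "left_mult (SymR UNIV) Pgroup"
  obtain \<phi> where \<phi>: "\<phi> \<in> hom G ((SymR UNIV)\<lparr>carrier := Pgroup\<rparr>)" "inj_on \<phi> (carrier G)"
    using finite_group_embeds_in_Pgroup G by blast
  have L: "?L \<in> hom ((SymR UNIV)\<lparr>carrier := Pgroup\<rparr>) ?A"
    using left_mult_hom_AutC[OF group_Delta_map M_infinity_is_perm_obj]
    by (simp only: monodromy_M_infinity pts)
  have hom: "?L \<circ> \<phi> \<in> hom G ?A"
    using \<phi>(1) L by (rule hom_compose)
  have "\<phi> ` carrier G \<subseteq> Pgroup"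
    using \<phi>(1) by (auto simp: hom_def)
  then have inj: "inj_on (?L \<circ> \<phi>) (carrier G)"
    using \<phi>(2) group.inj_on_left_mult[OF group_SymR subgroup_Pgroup]
    by (metis comp_inj_on inj_on_subset)
  have "group ?A"
    by (rule group_AutC[OF group_Delta_map
          min_regular_cover_is_perm_obj[OF group_Delta_map M_infinity_is_perm_obj]])
  with G hom interpret h: group_hom G ?A "?L \<circ> \<phi>"
    by (simp add: group_hom_def group_hom_axioms_def)
  let ?K = "(?L \<circ> \<phi>) ` carrier G"
  have "?L \<circ> \<phi> \<in> iso G (?A\<lparr>carrier := ?K\<rparr>)"
    using hom inj by (auto simp: iso_def hom_def bij_betw_def)
  then have "G \<cong> ?A\<lparr>carrier := ?K\<rparr>"
    by (rule is_isoI)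
  with h.img_is_subgroup show "\<exists>K. subgroup K ?A \<and> G \<cong> ?A\<lparr>carrier := K\<rparr>"
    by blast
qed

end
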